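(* Let $A\,|\,B\,|\,C$ be a left depth three tower of rings. Let $E=\operatorname{End}A_B$, $\mathcal J=\operatorname{End}{}_CA_B$, and $$A^{\mathcal J}=\{x\in A:\ \alpha(x)=\alpha(1)x\ \text{ for all }\alpha\in\mathcal J\}.$$ Then the map $x\mapsto\rho_x$ is an anti-isomorphism $A^{\mathcal J}\cong\operatorname{End}{}_EA$.
   Context: Rings are unital. A tower $A\,|\,B\,|\,C$ is a pair of unital ring homomorphisms $C\to B\to A$, with induced bimodule structures. It is left depth three if, as $C$-$A$-bimodules, $A\otimes_BA$ is isomorphic to a direct summand of $A^N$ for some positive integer $N$. $\operatorname{End}A_B$ is the ring of right $B$-linear endomorphisms of $A$ under composition, $\operatorname{End}{}_CA_B$ the ring of $C$-$B$-bimodule endomorphisms of $A$. $A$ is a left $E$-module by evaluation and $\operatorname{End}{}_EA$ is its ring of $E$-linear endomorphisms under composition. $\rho_x$ denotes right multiplication, $\rho_x(a)=ax$. *)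

theory Defs
  imports "HOL-Algebra.Algebra"
begin

section \<open>Bimodules\<close>

text \<open>
  The underlying abelian group of a bimodule is a \<^emph>\<open>multiplicatively written\<close> group record, so that
  products of groups, cosets and factor groups from the library apply directly.  The bimodule laws
  are not part of the record: all bimodules below are obtained from rings by constructions that
  satisfy them.
\<close>

record ('r, 's, 'm) bimod = "'m monoid" +
  lact :: "'r \<Rightarrow> 'm \<Rightarrow> 'm"
  ract :: "'m \<Rightarrow> 's \<Rightarrow> 'm"

definition bimod_hom ::
  "('r, 'x) ring_scheme \<Rightarrow> ('s, 'y) ring_scheme \<Rightarrow> ('r, 's, 'm, 'k) bimod_scheme
    \<Rightarrow> ('r, 's, 'n, 'l) bimod_scheme \<Rightarrow> ('m \<Rightarrow> 'n) set"
  where "bimod_hom R S M N = {h \<in> hom M N.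
    (\<forall>r\<in>carrier R. \<forall>m\<in>carrier M. h (lact M r m) = lact N r (h m)) \<and>
    (\<forall>m\<in>carrier M. \<forall>s\<in>carrier S. h (ract M m s) = ract N (h m) s)}"

definition bimod_iso ::
  "('r, 'x) ring_scheme \<Rightarrow> ('s, 'y) ring_scheme \<Rightarrow> ('r, 's, 'm, 'k) bimod_scheme
    \<Rightarrow> ('r, 's, 'n, 'l) bimod_scheme \<Rightarrow> ('m \<Rightarrow> 'n) set"
  where "bimod_iso R S M N = {h \<in> bimod_hom R S M N. bij_betw h (carrier M) (carrier N)}"

definition sub_bimod ::
  "('r, 'x) ring_scheme \<Rightarrow> ('s, 'y) ring_scheme \<Rightarrow> 'm set \<Rightarrow> ('r, 's, 'm, 'k) bimod_scheme \<Rightarrow> bool"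
  where "sub_bimod R S P M \<longleftrightarrow> subgroup P M \<and>
    (\<forall>r\<in>carrier R. \<forall>p\<in>P. lact M r p \<in> P) \<and> (\<forall>p\<in>P. \<forall>s\<in>carrier S. ract M p s \<in> P)"

definition direct_summand ::
  "('r, 'x) ring_scheme \<Rightarrow> ('s, 'y) ring_scheme \<Rightarrow> 'm set \<Rightarrow> ('r, 's, 'm, 'k) bimod_scheme \<Rightarrow> bool"
  where "direct_summand R S P M \<longleftrightarrow> sub_bimod R S P M \<and>
    (\<exists>Q. sub_bimod R S Q M \<and> P \<inter> Q = {\<one>\<^bsub>M\<^esub>} \<and> P <#>\<^bsub>M\<^esub> Q = carrier M)"

definition power_bimod :: "('r, 's, 'm, 'k) bimod_scheme \<Rightarrow> nat \<Rightarrow> ('r, 's, nat \<Rightarrow> 'm) bimod"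
  where "power_bimod M N = monoid.extend (product_group {..<N} (\<lambda>_. M))
    \<lparr>lact = (\<lambda>r v. \<lambda>i\<in>{..<N}. lact M r (v i)), ract = (\<lambda>v s. \<lambda>i\<in>{..<N}. ract M (v i) s)\<rparr>"


section \<open>The tensor product over a ring\<close>

text \<open>
  For a right \<open>B\<close>-module \<open>M\<close> and a left \<open>B\<close>-module \<open>N\<close>, the group underlying \<open>M \<otimes>\<^sub>B N\<close> is the factor
  of the free abelian group on \<open>M \<times> N\<close> by the subgroup generated by the balancing relations.
  That free abelian group is additive (elements are \<open>'m \<times> 'n \<Rightarrow>\<^sub>0 int\<close>), the factor group is written
  multiplicatively.
\<close>

definition tensor_free ::
  "('r, 'b, 'm, 'k) bimod_scheme \<Rightarrow> ('b, 's, 'n, 'l) bimod_scheme \<Rightarrow> ('m \<times> 'n \<Rightarrow>\<^sub>0 int) monoid"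
  where "tensor_free M N = free_Abelian_group (carrier M \<times> carrier N)"

definition tensor_rel ::
  "('b, 'x) ring_scheme \<Rightarrow> ('r, 'b, 'm, 'k) bimod_scheme \<Rightarrow> ('b, 's, 'n, 'l) bimod_scheme
    \<Rightarrow> ('m \<times> 'n \<Rightarrow>\<^sub>0 int) set"
  where "tensor_rel B M N = generate (tensor_free M N)
     ({frag_of (m \<otimes>\<^bsub>M\<^esub> m', n) - frag_of (m, n) - frag_of (m', n) | m m' n.
         m \<in> carrier M \<and> m' \<in> carrier M \<and> n \<in> carrier N} \<union>
      {frag_of (m, n \<otimes>\<^bsub>N\<^esub> n') - frag_of (m, n) - frag_of (m, n') | m n n'.
         m \<in> carrier M \<and> n \<in> carrier N \<and> n' \<in> carrier N} \<union>
      {frag_of (ract M m b, n) - frag_of (m, lact N b n) | m b n.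
         m \<in> carrier M \<and> b \<in> carrier B \<and> n \<in> carrier N})"

text \<open>
  The outer actions are induced by \<open>r (m \<otimes> n) = (r m) \<otimes> n\<close> and \<open>(m \<otimes> n) s = m \<otimes> (n s)\<close>.  On a coset
  they are given as the union of the cosets of the images of all representatives; these cosets
  coincide.
\<close>

definition tensor_bimod ::
  "('b, 'x) ring_scheme \<Rightarrow> ('r, 'b, 'm, 'k) bimod_scheme \<Rightarrow> ('b, 's, 'n, 'l) bimod_scheme
    \<Rightarrow> ('r, 's, ('m \<times> 'n \<Rightarrow>\<^sub>0 int) set) bimod"
  where "tensor_bimod B M N = monoid.extend (tensor_free M N Mod tensor_rel B M N)
    \<lparr>lact = (\<lambda>r U. \<Union>t\<in>U. tensor_rel B M N #>\<^bsub>tensor_free M N\<^esub>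
        frag_extend (\<lambda>(m, n). frag_of (lact M r m, n)) t),
     ract = (\<lambda>U s. \<Union>t\<in>U. tensor_rel B M N #>\<^bsub>tensor_free M N\<^esub>
        frag_extend (\<lambda>(m, n). frag_of (m, ract N n s)) t)\<rparr>"


section \<open>Towers of rings\<close>

text \<open>A ring homomorphism in the sense of \<^const>\<open>ring_hom\<close> preserves the unit.\<close>

definition ring_tower ::
  "('a, 'x) ring_scheme \<Rightarrow> ('b, 'y) ring_scheme \<Rightarrow> ('c, 'z) ring_scheme \<Rightarrow> ('b \<Rightarrow> 'a) \<Rightarrow> ('c \<Rightarrow> 'b) \<Rightarrow> bool"
  where "ring_tower A B C \<phi> \<psi> \<longleftrightarrow>
    ring A \<and> ring B \<and> ring C \<and> \<phi> \<in> ring_hom B A \<and> \<psi> \<in> ring_hom C B"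

text \<open>The ring \<open>A\<close> as a bimodule via two ring homomorphisms \<open>f\<close> and \<open>g\<close> into \<open>A\<close>.\<close>

definition induced_bimod :: "('a, 'x) ring_scheme \<Rightarrow> ('r \<Rightarrow> 'a) \<Rightarrow> ('s \<Rightarrow> 'a) \<Rightarrow> ('r, 's, 'a) bimod"
  where "induced_bimod A f g = monoid.extend (monoid.truncate (add_monoid A))
    \<lparr>lact = (\<lambda>r a. f r \<otimes>\<^bsub>A\<^esub> a), ract = (\<lambda>a s. a \<otimes>\<^bsub>A\<^esub> g s)\<rparr>"

definition left_depth_three ::
  "('a, 'x) ring_scheme \<Rightarrow> ('b, 'y) ring_scheme \<Rightarrow> ('c, 'z) ring_scheme \<Rightarrow> ('b \<Rightarrow> 'a) \<Rightarrow> ('c \<Rightarrow> 'b) \<Rightarrow> bool"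
  where "left_depth_three A B C \<phi> \<psi> \<longleftrightarrow>
    (\<exists>N>0. \<exists>P. direct_summand C A P (power_bimod (induced_bimod A (\<phi> \<circ> \<psi>) id) N) \<and>
      bimod_iso C A
        (tensor_bimod B (induced_bimod A (\<phi> \<circ> \<psi>) \<phi>) (induced_bimod A \<phi> id))
        ((power_bimod (induced_bimod A (\<phi> \<circ> \<psi>) id) N)\<lparr>carrier := P\<rparr>) \<noteq> {})"


section \<open>Endomorphism rings\<close>

text \<open>
  Endomorphisms of \<open>A\<close> are functions that are \<^const>\<open>undefined\<close> outside the carrier, so that equality of
  functions is equality on the carrier.
\<close>

definition additive_endos :: "('a, 'x) ring_scheme \<Rightarrow> ('a \<Rightarrow> 'a) set"
  where "additive_endos A = hom (add_monoid A) (add_monoid A) \<inter> extensional (carrier A)"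

definition endo_ring :: "('a, 'x) ring_scheme \<Rightarrow> ('a \<Rightarrow> 'a) set \<Rightarrow> ('a \<Rightarrow> 'a) ring"
  where "endo_ring A F =
    \<lparr>carrier = F, monoid.mult = compose (carrier A), one = (\<lambda>x\<in>carrier A. x),
     ring.zero = (\<lambda>x\<in>carrier A. \<zero>\<^bsub>A\<^esub>), ring.add = (\<lambda>f g. \<lambda>x\<in>carrier A. f x \<oplus>\<^bsub>A\<^esub> g x)\<rparr>"

definition End_right :: "('a, 'x) ring_scheme \<Rightarrow> ('b, 'y) ring_scheme \<Rightarrow> ('b \<Rightarrow> 'a) \<Rightarrow> ('a \<Rightarrow> 'a) ring"
  where "End_right A B \<phi> = endo_ring A {f \<in> additive_endos A.
    \<forall>x\<in>carrier A. \<forall>b\<in>carrier B. f (x \<otimes>\<^bsub>A\<^esub> \<phi> b) = f x \<otimes>\<^bsub>A\<^esub> \<phi> b}"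

definition End_bimod ::
  "('a, 'x) ring_scheme \<Rightarrow> ('b, 'y) ring_scheme \<Rightarrow> ('c, 'z) ring_scheme \<Rightarrow> ('b \<Rightarrow> 'a) \<Rightarrow> ('c \<Rightarrow> 'b)
    \<Rightarrow> ('a \<Rightarrow> 'a) ring"
  where "End_bimod A B C \<phi> \<psi> = endo_ring A {f \<in> additive_endos A.
    f \<in> bimod_hom C B (induced_bimod A (\<phi> \<circ> \<psi>) \<phi>) (induced_bimod A (\<phi> \<circ> \<psi>) \<phi>)}"

text \<open>
  In \<open>End_eval A E\<close>, \<open>E\<close> is a ring of endomorphisms of \<open>A\<close>, acting on \<open>A\<close> from the left by evaluation \<open>f \<cdot> x = f x\<close>.
\<close>

definition End_eval :: "('a, 'x) ring_scheme \<Rightarrow> ('a \<Rightarrow> 'a, 'y) ring_scheme \<Rightarrow> ('a \<Rightarrow> 'a) ring"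
  where "End_eval A E = endo_ring A {g \<in> additive_endos A.
    \<forall>f\<in>carrier E. \<forall>x\<in>carrier A. g (f x) = f (g x)}"

definition endo_invariants :: "('a, 'x) ring_scheme \<Rightarrow> ('a \<Rightarrow> 'a, 'y) ring_scheme \<Rightarrow> 'a set"
  where "endo_invariants A J = {x \<in> carrier A. \<forall>\<alpha>\<in>carrier J. \<alpha> x = \<alpha> \<one>\<^bsub>A\<^esub> \<otimes>\<^bsub>A\<^esub> x}"

definition right_mult :: "('a, 'x) ring_scheme \<Rightarrow> 'a \<Rightarrow> 'a \<Rightarrow> 'a"
  where "right_mult A x = (\<lambda>a\<in>carrier A. a \<otimes>\<^bsub>A\<^esub> x)"

text \<open>An anti-isomorphism onto \<open>S\<close> is an isomorphism from the opposite ring of \<open>R\<close>.\<close>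

definition ring_anti_iso :: "('a, 'x) ring_scheme \<Rightarrow> ('b, 'y) ring_scheme \<Rightarrow> ('a \<Rightarrow> 'b) set"
  where "ring_anti_iso R S = {h. ring R \<and> ring S \<and>
    h \<in> ring_iso (R\<lparr>monoid.mult := \<lambda>x y. y \<otimes>\<^bsub>R\<^esub> x\<rparr>) S}"

end

theory Submission
  imports Defs
begin

text \<open>
  Write \<open>E = End A\<^sub>B\<close> and \<open>J = End \<^sub>CA\<^sub>B\<close>, so \<open>J \<subseteq> E\<close>.  Left multiplications are right \<open>B\<close>-linear,
  hence an \<open>E\<close>-linear \<open>g\<close> commutes with all of them and is right multiplication by \<open>g(1)\<close>.
  Since \<open>E\<close> is closed under composition with left multiplications, \<open>\<rho>\<^sub>x\<close> is \<open>E\<close>-linear exactly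
  when \<open>f(x) = f(1) x\<close> for all \<open>f \<in> E\<close>.  The invariants \<open>A\<^sup>J\<close> are defined by the same equation for
  \<open>f \<in> J\<close> alone, so the theorem says that testing against the smaller set \<open>J\<close> suffices.
  This is where depth three enters.

  Depth three embeds \<open>A \<otimes>\<^sub>B A\<close> into some \<open>A\<^sup>N\<close> by a \<open>C\<close>-\<open>A\<close>-linear map \<open>h\<close>.  For each coordinate
  \<open>i\<close>, the map \<open>\<gamma>\<^sub>i a = (h (a \<otimes> 1))\<^sub>i\<close> is left \<open>C\<close>-linear, and right \<open>B\<close>-linear because
  \<open>a b \<otimes> 1 = a \<otimes> b = (a \<otimes> 1) b\<close>; so \<open>\<gamma>\<^sub>i \<in> J\<close> (\<open>component_in_End_bimod\<close>).  For \<open>x \<in> A\<^sup>J\<close> this gives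
  \<open>h (x \<otimes> 1) = h (1 \<otimes> 1) x = h (1 \<otimes> x)\<close> in every coordinate, and injectivity of \<open>h\<close> yields
  \<open>x \<otimes> 1 = 1 \<otimes> x\<close> in \<open>A \<otimes>\<^sub>B A\<close> (\<open>invariant_tensor_swap\<close>).  Every \<open>f \<in> E\<close> induces the additive map
  \<open>a \<otimes> b \<mapsto> f(a) b\<close> on \<open>A \<otimes>\<^sub>B A\<close>, and applying it to this identity gives \<open>f(x) = f(1) x\<close>
  (\<open>endo_invariants_eq\<close>).

  With invariance under all of \<open>E\<close> available, \<open>A\<^sup>J\<close> is visibly closed under multiplication, and
  the ring structure of \<open>End \<^sub>EA\<close> is transported along \<open>x \<mapsto> \<rho>\<^sub>x\<close> from the opposite ring of \<open>A\<^sup>J\<close>.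
\<close>

section \<open>Pure tensors\<close>

definition pure_tensor ::
  "('b, 'x) ring_scheme \<Rightarrow> ('r, 'b, 'm, 'k) bimod_scheme \<Rightarrow> ('b, 's, 'n, 'l) bimod_scheme
    \<Rightarrow> 'm \<Rightarrow> 'n \<Rightarrow> ('m \<times> 'n \<Rightarrow>\<^sub>0 int) set"
  where "pure_tensor B M N m n = tensor_rel B M N #>\<^bsub>tensor_free M N\<^esub> frag_of (m, n)"

definition tensor_relators ::
  "('b, 'x) ring_scheme \<Rightarrow> ('r, 'b, 'm, 'k) bimod_scheme \<Rightarrow> ('b, 's, 'n, 'l) bimod_scheme
    \<Rightarrow> ('m \<times> 'n \<Rightarrow>\<^sub>0 int) set"
  where "tensor_relators B M N =
     {frag_of (m \<otimes>\<^bsub>M\<^esub> m', n) - frag_of (m, n) - frag_of (m', n) | m m' n.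
         m \<in> carrier M \<and> m' \<in> carrier M \<and> n \<in> carrier N} \<union>
      {frag_of (m, n \<otimes>\<^bsub>N\<^esub> n') - frag_of (m, n) - frag_of (m, n') | m n n'.
         m \<in> carrier M \<and> n \<in> carrier N \<and> n' \<in> carrier N} \<union>
      {frag_of (ract M m b, n) - frag_of (m, lact N b n) | m b n.
         m \<in> carrier M \<and> b \<in> carrier B \<and> n \<in> carrier N}"

lemma tensor_rel_generate:
  "tensor_rel B M N = generate (tensor_free M N) (tensor_relators B M N)"
  unfolding tensor_rel_def tensor_relators_def ..

lemma tensor_relatorsE:
  assumes "t \<in> tensor_relators B M N"
  obtains (left) m m' n where "m \<in> carrier M" "m' \<in> carrier M" "n \<in> carrier N"
      "t = frag_of (m \<otimes>\<^bsub>M\<^esub> m', n) - frag_of (m, n) - frag_of (m', n)"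
    | (right) m n n' where "m \<in> carrier M" "n \<in> carrier N" "n' \<in> carrier N"
      "t = frag_of (m, n \<otimes>\<^bsub>N\<^esub> n') - frag_of (m, n) - frag_of (m, n')"
    | (balance) m b n where "m \<in> carrier M" "b \<in> carrier B" "n \<in> carrier N"
      "t = frag_of (ract M m b, n) - frag_of (m, lact N b n)"
  using assms unfolding tensor_relators_def by blast

lemma comm_group_tensor_free: "comm_group (tensor_free M N)"
  unfolding tensor_free_def by (rule abelian_free_Abelian_group)

lemma carrier_tensor_free_iff:
  "t \<in> carrier (tensor_free M N) \<longleftrightarrow> Poly_Mapping.keys t \<subseteq> carrier M \<times> carrier N"
  by (simp add: tensor_free_def)

lemma mult_tensor_free: "s \<otimes>\<^bsub>tensor_free M N\<^esub> t = s + t"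
  by (simp add: tensor_free_def)

lemma inv_tensor_free:
  "t \<in> carrier (tensor_free M N) \<Longrightarrow> inv\<^bsub>tensor_free M N\<^esub> t = - t"
  by (simp add: tensor_free_def)

lemma tensor_free_closed:
  "\<lbrakk>m \<in> carrier M; n \<in> carrier N\<rbrakk> \<Longrightarrow> frag_of (m, n) \<in> carrier (tensor_free M N)"
  "\<lbrakk>s \<in> carrier (tensor_free M N); t \<in> carrier (tensor_free M N)\<rbrakk>
    \<Longrightarrow> s + t \<in> carrier (tensor_free M N)"
  "\<lbrakk>s \<in> carrier (tensor_free M N); t \<in> carrier (tensor_free M N)\<rbrakk>
    \<Longrightarrow> s - t \<in> carrier (tensor_free M N)"
  unfolding carrier_tensor_free_iff
  using keys_add[of s t] keys_diff[of s t] by auto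

text \<open>
  These closure properties put the balancing relations inside the free abelian
  group on \<open>M \<times> N\<close>, so that they generate a (normal) subgroup of it.
\<close>

locale tensor_factors =
  fixes B :: "('b, 'x) ring_scheme" and M :: "('r, 'b, 'm, 'k) bimod_scheme"
    and N :: "('b, 's, 'n, 'l) bimod_scheme"
  assumes left_factor_closed: "\<lbrakk>m \<in> carrier M; m' \<in> carrier M\<rbrakk> \<Longrightarrow> m \<otimes>\<^bsub>M\<^esub> m' \<in> carrier M"
    and right_factor_closed: "\<lbrakk>n \<in> carrier N; n' \<in> carrier N\<rbrakk> \<Longrightarrow> n \<otimes>\<^bsub>N\<^esub> n' \<in> carrier N"
    and ract_closed: "\<lbrakk>m \<in> carrier M; b \<in> carrier B\<rbrakk> \<Longrightarrow> ract M m b \<in> carrier M"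
    and lact_closed: "\<lbrakk>b \<in> carrier B; n \<in> carrier N\<rbrakk> \<Longrightarrow> lact N b n \<in> carrier N"
begin

lemma tensor_relators_subset: "tensor_relators B M N \<subseteq> carrier (tensor_free M N)"
proof
  fix t assume "t \<in> tensor_relators B M N"
  then show "t \<in> carrier (tensor_free M N)"
    by (cases rule: tensor_relatorsE)
      (auto intro!: tensor_free_closed left_factor_closed right_factor_closed ract_closed lact_closed)
qed

lemma tensor_rel_subgroup: "subgroup (tensor_rel B M N) (tensor_free M N)"
  unfolding tensor_rel_generate
  by (intro group.generate_is_subgroup tensor_relators_subset
      comm_group.axioms(2) comm_group_tensor_free)

lemma tensor_rel_normal: "tensor_rel B M N \<lhd> tensor_free M N"
  by (intro comm_group.subgroup_imp_normal comm_group_tensor_free tensor_rel_subgroup)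

lemma tensor_rel_closed:
  "s \<in> tensor_rel B M N \<Longrightarrow> s \<in> carrier (tensor_free M N)"
  "\<lbrakk>s \<in> tensor_rel B M N; t \<in> tensor_rel B M N\<rbrakk> \<Longrightarrow> s + t \<in> tensor_rel B M N"
  "s \<in> tensor_rel B M N \<Longrightarrow> - s \<in> tensor_rel B M N"
  using subgroup.mem_carrier[OF tensor_rel_subgroup]
    subgroup.m_closed[OF tensor_rel_subgroup] subgroup.m_inv_closed[OF tensor_rel_subgroup]
  by (auto simp: mult_tensor_free) (metis inv_tensor_free)

lemma relator_in_tensor_rel: "t \<in> tensor_relators B M N \<Longrightarrow> t \<in> tensor_rel B M N"
  unfolding tensor_rel_generate by (rule generate.incl)

lemma tensor_coset_eq_iff:
  assumes "s \<in> carrier (tensor_free M N)" "t \<in> carrier (tensor_free M N)"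
  shows "tensor_rel B M N #>\<^bsub>tensor_free M N\<^esub> s = tensor_rel B M N #>\<^bsub>tensor_free M N\<^esub> t
    \<longleftrightarrow> s - t \<in> tensor_rel B M N"
proof -
  interpret F: comm_group "tensor_free M N" by (rule comm_group_tensor_free)
  let ?R = "tensor_rel B M N"
  have "s - t \<in> ?R \<longleftrightarrow> s \<in> ?R #>\<^bsub>tensor_free M N\<^esub> t"
    by (force simp: r_coset_def mult_tensor_free)
  also have "\<dots> \<longleftrightarrow> ?R #>\<^bsub>tensor_free M N\<^esub> s = ?R #>\<^bsub>tensor_free M N\<^esub> t"
    using F.repr_independence[OF _ assms(2) tensor_rel_subgroup]
      F.rcos_self[OF assms(1) tensor_rel_subgroup] by metis
  finally show ?thesis by simp
qed

lemma pure_tensor_closed: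
  "\<lbrakk>m \<in> carrier M; n \<in> carrier N\<rbrakk> \<Longrightarrow> pure_tensor B M N m n \<in> carrier (tensor_bimod B M N)"
  unfolding pure_tensor_def tensor_bimod_def
  by (auto simp: monoid.defs FactGroup_def RCOSETS_def intro: tensor_free_closed)

lemma mult_tensor_coset:
  assumes "s \<in> carrier (tensor_free M N)" "t \<in> carrier (tensor_free M N)"
  shows "(tensor_rel B M N #>\<^bsub>tensor_free M N\<^esub> s) \<otimes>\<^bsub>tensor_bimod B M N\<^esub>
      (tensor_rel B M N #>\<^bsub>tensor_free M N\<^esub> t)
    = tensor_rel B M N #>\<^bsub>tensor_free M N\<^esub> (s + t)"
  using normal.rcos_sum[OF tensor_rel_normal assms]
  by (simp add: tensor_bimod_def monoid.defs FactGroup_def mult_tensor_free)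

lemma pure_tensor_add_left:
  assumes "m \<in> carrier M" "m' \<in> carrier M" "n \<in> carrier N"
  shows "pure_tensor B M N (m \<otimes>\<^bsub>M\<^esub> m') n
    = pure_tensor B M N m n \<otimes>\<^bsub>tensor_bimod B M N\<^esub> pure_tensor B M N m' n"
proof -
  have "frag_of (m \<otimes>\<^bsub>M\<^esub> m', n) - frag_of (m, n) - frag_of (m', n) \<in> tensor_relators B M N"
    using assms unfolding tensor_relators_def by blast
  then have "frag_of (m \<otimes>\<^bsub>M\<^esub> m', n) - (frag_of (m, n) + frag_of (m', n)) \<in> tensor_rel B M N"
    by (metis relator_in_tensor_rel diff_diff_eq)
  then show ?thesis
    using assms unfolding pure_tensor_def
    by (simp add: mult_tensor_coset tensor_free_closed left_factor_closed tensor_coset_eq_iff)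
qed

lemma pure_tensor_balanced:
  assumes "m \<in> carrier M" "b \<in> carrier B" "n \<in> carrier N"
  shows "pure_tensor B M N (ract M m b) n = pure_tensor B M N m (lact N b n)"
proof -
  have "frag_of (ract M m b, n) - frag_of (m, lact N b n) \<in> tensor_relators B M N"
    using assms unfolding tensor_relators_def by blast
  then show ?thesis
    using assms unfolding pure_tensor_def
    by (simp add: tensor_free_closed ract_closed lact_closed tensor_coset_eq_iff
        relator_in_tensor_rel)
qed

lemma frag_extend_tensor_free_closed:
  assumes "\<And>m n. \<lbrakk>m \<in> carrier M; n \<in> carrier N\<rbrakk> \<Longrightarrow> e (m, n) \<in> carrier (tensor_free M N)"
    and "t \<in> carrier (tensor_free M N)"
  shows "frag_extend e t \<in> carrier (tensor_free M N)"
  using assms keys_frag_extend[of e t] unfolding carrier_tensor_free_iff by fastforce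

text \<open>
  An additive endomorphism of the free group descends to the tensor product as soon as it sends
  the generating relators to relations.
\<close>

lemma frag_extend_tensor_rel:
  assumes relators: "\<And>t. t \<in> tensor_relators B M N \<Longrightarrow> frag_extend e t \<in> tensor_rel B M N"
    and t: "t \<in> tensor_rel B M N"
  shows "frag_extend e t \<in> tensor_rel B M N"
  using t[unfolded tensor_rel_generate]
proof (induction rule: generate.induct)
  case one
  show ?case
    using subgroup.one_closed[OF tensor_rel_subgroup] by (simp add: tensor_free_def)
next
  case (incl h)
  then show ?case by (rule relators)
next
  case (inv h)
  then show ?case
    using relators[OF inv] tensor_relators_subset
    by (auto simp: inv_tensor_free frag_extend_minus tensor_rel_closed)
next
  case (eng h1 h2)
  then show ?case
    by (simp add: mult_tensor_free frag_extend_add tensor_rel_closed)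
qed

text \<open>
  The outer actions on the tensor product are unions over all representatives of a coset.  When the
  map on representatives preserves the relations, all the cosets in the union coincide, so the
  action can be computed on one representative.
\<close>

lemma Union_image_tensor_coset:
  assumes closed: "\<And>m n. \<lbrakk>m \<in> carrier M; n \<in> carrier N\<rbrakk> \<Longrightarrow> e (m, n) \<in> carrier (tensor_free M N)"
    and relators: "\<And>t. t \<in> tensor_relators B M N \<Longrightarrow> frag_extend e t \<in> tensor_rel B M N"
    and u: "u \<in> carrier (tensor_free M N)"
  shows "(\<Union>t\<in>tensor_rel B M N #>\<^bsub>tensor_free M N\<^esub> u.
      tensor_rel B M N #>\<^bsub>tensor_free M N\<^esub> frag_extend e t)
    = tensor_rel B M N #>\<^bsub>tensor_free M N\<^esub> frag_extend e u"
proof -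
  interpret F: comm_group "tensor_free M N" by (rule comm_group_tensor_free)
  let ?R = "tensor_rel B M N"
  have "?R #>\<^bsub>tensor_free M N\<^esub> frag_extend e t = ?R #>\<^bsub>tensor_free M N\<^esub> frag_extend e u"
    if t: "t \<in> ?R #>\<^bsub>tensor_free M N\<^esub> u" for t
  proof -
    obtain r where r: "r \<in> ?R" "t = r + u"
      using t by (auto simp: r_coset_def mult_tensor_free)
    then have "t \<in> carrier (tensor_free M N)"
      using u by (simp add: tensor_free_closed tensor_rel_closed)
    moreover have "frag_extend e t - frag_extend e u = frag_extend e r"
      using r by (simp add: frag_extend_add)
    moreover have "frag_extend e r \<in> ?R"
      by (rule frag_extend_tensor_rel[OF relators r(1)])
    ultimately show ?thesis
      by (simp add: tensor_coset_eq_iff frag_extend_tensor_free_closed closed u)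
  qed
  moreover have "u \<in> ?R #>\<^bsub>tensor_free M N\<^esub> u"
    using u tensor_rel_subgroup by (rule F.rcos_self)
  ultimately show ?thesis by blast
qed

lemma lact_pure_tensor:
  assumes closed: "\<And>m. m \<in> carrier M \<Longrightarrow> lact M r m \<in> carrier M"
    and additive: "\<And>m m'. \<lbrakk>m \<in> carrier M; m' \<in> carrier M\<rbrakk>
      \<Longrightarrow> lact M r (m \<otimes>\<^bsub>M\<^esub> m') = lact M r m \<otimes>\<^bsub>M\<^esub> lact M r m'"
    and commute: "\<And>m b. \<lbrakk>m \<in> carrier M; b \<in> carrier B\<rbrakk>
      \<Longrightarrow> lact M r (ract M m b) = ract M (lact M r m) b"
    and mn: "m \<in> carrier M" "n \<in> carrier N"
  shows "lact (tensor_bimod B M N) r (pure_tensor B M N m n) = pure_tensor B M N (lact M r m) n"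
proof -
  let ?e = "\<lambda>(m, n). frag_of (lact M r m, n)"
  have rel: "frag_extend ?e t \<in> tensor_rel B M N" if "t \<in> tensor_relators B M N" for t
    using that
  proof (cases rule: tensor_relatorsE)
    case (left m m' n)
    then show ?thesis
      using closed[of m] closed[of m']
      by (intro relator_in_tensor_rel)
        (auto simp: frag_extend_diff additive tensor_relators_def)
  next
    case (right m n n')
    then show ?thesis
      using closed[of m]
      by (intro relator_in_tensor_rel) (auto simp: frag_extend_diff tensor_relators_def)
  next
    case (balance m b n)
    then show ?thesis
      using closed[of m]
      by (intro relator_in_tensor_rel) (auto simp: frag_extend_diff commute tensor_relators_def)
  qed
  have cl: "?e (m, n) \<in> carrier (tensor_free M N)" if "m \<in> carrier M" "n \<in> carrier N" for m n
    using that by (simp add: tensor_free_closed closed)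
  show ?thesis
    using Union_image_tensor_coset[of ?e, OF cl rel tensor_free_closed(1)[OF mn]]
    by (simp add: tensor_bimod_def pure_tensor_def monoid.defs)
qed

lemma ract_pure_tensor:
  assumes closed: "\<And>n. n \<in> carrier N \<Longrightarrow> ract N n s \<in> carrier N"
    and additive: "\<And>n n'. \<lbrakk>n \<in> carrier N; n' \<in> carrier N\<rbrakk>
      \<Longrightarrow> ract N (n \<otimes>\<^bsub>N\<^esub> n') s = ract N n s \<otimes>\<^bsub>N\<^esub> ract N n' s"
    and commute: "\<And>b n. \<lbrakk>b \<in> carrier B; n \<in> carrier N\<rbrakk>
      \<Longrightarrow> ract N (lact N b n) s = lact N b (ract N n s)"
    and mn: "m \<in> carrier M" "n \<in> carrier N"
  shows "ract (tensor_bimod B M N) (pure_tensor B M N m n) s = pure_tensor B M N m (ract N n s)"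
proof -
  let ?e = "\<lambda>(m, n). frag_of (m, ract N n s)"
  have rel: "frag_extend ?e t \<in> tensor_rel B M N" if "t \<in> tensor_relators B M N" for t
    using that
  proof (cases rule: tensor_relatorsE)
    case (left m m' n)
    then show ?thesis
      using closed[of n]
      by (intro relator_in_tensor_rel) (auto simp: frag_extend_diff tensor_relators_def)
  next
    case (right m n n')
    then show ?thesis
      using closed[of n] closed[of n']
      by (intro relator_in_tensor_rel)
        (auto simp: frag_extend_diff additive tensor_relators_def)
  next
    case (balance m b n)
    then show ?thesis
      using closed[of n]
      by (intro relator_in_tensor_rel) (auto simp: frag_extend_diff commute tensor_relators_def)
  qed
  have cl: "?e (m, n) \<in> carrier (tensor_free M N)" if "m \<in> carrier M" "n \<in> carrier N" for m n
    using that by (simp add: tensor_free_closed closed)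
  show ?thesis
    using Union_image_tensor_coset[of ?e, OF cl rel tensor_free_closed(1)[OF mn]]
    by (simp add: tensor_bimod_def pure_tensor_def monoid.defs)
qed

text \<open>
  The universal property of the tensor product, in the form of its consequence for pure tensors:
  the homomorphism that \<open>\<beta>\<close> induces on the free group kills all relators, hence takes equal
  values on representatives of the same coset.
\<close>

lemma balanced_map_eq:
  fixes G (structure) and \<beta> :: "'m \<Rightarrow> 'n \<Rightarrow> 'g"
  assumes G: "comm_group G"
    and closed: "\<And>m n. \<lbrakk>m \<in> carrier M; n \<in> carrier N\<rbrakk> \<Longrightarrow> \<beta> m n \<in> carrier G"
    and left: "\<And>m m' n. \<lbrakk>m \<in> carrier M; m' \<in> carrier M; n \<in> carrier N\<rbrakk>
      \<Longrightarrow> \<beta> (m \<otimes>\<^bsub>M\<^esub> m') n = \<beta> m n \<otimes> \<beta> m' n"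
    and right: "\<And>m n n'. \<lbrakk>m \<in> carrier M; n \<in> carrier N; n' \<in> carrier N\<rbrakk>
      \<Longrightarrow> \<beta> m (n \<otimes>\<^bsub>N\<^esub> n') = \<beta> m n \<otimes> \<beta> m n'"
    and balance: "\<And>m b n. \<lbrakk>m \<in> carrier M; b \<in> carrier B; n \<in> carrier N\<rbrakk>
      \<Longrightarrow> \<beta> (ract M m b) n = \<beta> m (lact N b n)"
    and mn: "m \<in> carrier M" "n \<in> carrier N" "m' \<in> carrier M" "n' \<in> carrier N"
    and eq: "pure_tensor B M N m n = pure_tensor B M N m' n'"
  shows "\<beta> m n = \<beta> m' n'"
proof -
  interpret G: comm_group G by fact
  interpret F: comm_group "tensor_free M N" by (rule comm_group_tensor_free)
  have "case_prod \<beta> ` (carrier M \<times> carrier N) \<subseteq> carrier G"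
    using closed by auto
  then obtain h where h: "h \<in> hom (tensor_free M N) G"
    and h_of: "\<And>p. p \<in> carrier M \<times> carrier N \<Longrightarrow> h (frag_of p) = case_prod \<beta> p"
    using G.free_Abelian_group_universal unfolding tensor_free_def by blast
  interpret h: group_hom "tensor_free M N" G h
    using h by unfold_locales
  have h_diff: "h (s - t) = h s \<otimes> inv h t"
    if "s \<in> carrier (tensor_free M N)" "t \<in> carrier (tensor_free M N)" for s t
  proof -
    have "s - t = s \<otimes>\<^bsub>tensor_free M N\<^esub> inv\<^bsub>tensor_free M N\<^esub> t"
      using that by (simp add: mult_tensor_free inv_tensor_free)
    then show ?thesis using that by simp
  qed
  have cancel: "u \<otimes> v \<otimes> inv u \<otimes> inv v = \<one>" if "u \<in> carrier G" "v \<in> carrier G" for u v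
  proof -
    have "u \<otimes> v \<otimes> inv u \<otimes> inv v = u \<otimes> v \<otimes> inv (u \<otimes> v)"
      using that by (simp add: G.inv_mult G.m_assoc)
    then show ?thesis using that by simp
  qed
  have "tensor_relators B M N \<subseteq> kernel (tensor_free M N) G h"
  proof
    fix t assume t: "t \<in> tensor_relators B M N"
    then have "h t = \<one>"
      by (cases rule: tensor_relatorsE)
        (auto simp: h_diff h_of tensor_free_closed left_factor_closed right_factor_closed
          ract_closed lact_closed closed left right balance cancel)
    then show "t \<in> kernel (tensor_free M N) G h"
      using t tensor_relators_subset by (auto simp: kernel_def)
  qed
  then have "tensor_rel B M N \<subseteq> kernel (tensor_free M N) G h"
    unfolding tensor_rel_generate
    by (intro F.generate_subgroup_incl h.subgroup_kernel)
  moreover have "frag_of (m, n) - frag_of (m', n') \<in> tensor_rel B M N"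
    using eq mn by (simp add: pure_tensor_def tensor_coset_eq_iff tensor_free_closed)
  ultimately have "h (frag_of (m, n) - frag_of (m', n')) = \<one>"
    by (auto simp: kernel_def)
  then have "\<beta> m n \<otimes> inv \<beta> m' n' = \<one>"
    using mn by (simp add: h_diff h_of tensor_free_closed)
  then show ?thesis
    using mn closed G.inv_solve_right'[of "\<one>" "\<beta> m n" "\<beta> m' n'"] by auto
qed

end

section \<open>Endomorphisms of a ring and right multiplications\<close>

lemma induced_bimod_simps:
  "carrier (induced_bimod A f g) = carrier A"
  "monoid.mult (induced_bimod A f g) = ring.add A"
  "lact (induced_bimod A f g) = (\<lambda>r a. f r \<otimes>\<^bsub>A\<^esub> a)"
  "ract (induced_bimod A f g) = (\<lambda>a s. a \<otimes>\<^bsub>A\<^esub> g s)"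
  by (simp_all add: induced_bimod_def monoid.defs)

lemma power_bimod_simps:
  "carrier (power_bimod M n) = (\<Pi>\<^sub>E i\<in>{..<n}. carrier M)"
  "monoid.mult (power_bimod M n) = (\<lambda>v w. \<lambda>i\<in>{..<n}. v i \<otimes>\<^bsub>M\<^esub> w i)"
  "lact (power_bimod M n) = (\<lambda>r v. \<lambda>i\<in>{..<n}. lact M r (v i))"
  "ract (power_bimod M n) = (\<lambda>v s. \<lambda>i\<in>{..<n}. ract M (v i) s)"
  by (simp_all add: power_bimod_def monoid.defs)

lemma endo_ring_simps:
  "carrier (endo_ring A F) = F"
  "monoid.mult (endo_ring A F) = compose (carrier A)"
  "one (endo_ring A F) = (\<lambda>x\<in>carrier A. x)"
  "ring.zero (endo_ring A F) = (\<lambda>x\<in>carrier A. \<zero>\<^bsub>A\<^esub>)"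
  "ring.add (endo_ring A F) = (\<lambda>f g. \<lambda>x\<in>carrier A. f x \<oplus>\<^bsub>A\<^esub> g x)"
  by (simp_all add: endo_ring_def)

lemma additive_endos_iff:
  "f \<in> additive_endos A \<longleftrightarrow> f \<in> carrier A \<rightarrow>\<^sub>E carrier A \<and>
    (\<forall>x\<in>carrier A. \<forall>y\<in>carrier A. f (x \<oplus>\<^bsub>A\<^esub> y) = f x \<oplus>\<^bsub>A\<^esub> f y)"
  by (auto simp: additive_endos_def hom_def PiE_def)

lemma End_right_iff:
  "f \<in> carrier (End_right A B \<phi>) \<longleftrightarrow> f \<in> additive_endos A \<and>
    (\<forall>x\<in>carrier A. \<forall>b\<in>carrier B. f (x \<otimes>\<^bsub>A\<^esub> \<phi> b) = f x \<otimes>\<^bsub>A\<^esub> \<phi> b)"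
  by (simp add: End_right_def endo_ring_simps)

lemma End_bimod_iff:
  "f \<in> carrier (End_bimod A B C \<phi> \<psi>) \<longleftrightarrow> f \<in> carrier (End_right A B \<phi>) \<and>
    (\<forall>c\<in>carrier C. \<forall>x\<in>carrier A. f (\<phi> (\<psi> c) \<otimes>\<^bsub>A\<^esub> x) = \<phi> (\<psi> c) \<otimes>\<^bsub>A\<^esub> f x)"
  by (auto simp: End_bimod_def End_right_iff endo_ring_simps bimod_hom_def induced_bimod_simps
      additive_endos_def hom_def)

lemma End_eval_iff:
  "g \<in> carrier (End_eval A E) \<longleftrightarrow> g \<in> additive_endos A \<and>
    (\<forall>f\<in>carrier E. \<forall>x\<in>carrier A. g (f x) = f (g x))"
  by (simp add: End_eval_def endo_ring_simps)

lemma (in ring) left_mult_in_End_right: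
  assumes "\<phi> \<in> carrier B \<rightarrow> carrier R" "a \<in> carrier R"
  shows "(\<lambda>x\<in>carrier R. a \<otimes> x) \<in> carrier (End_right R B \<phi>)"
  using assms by (auto simp: End_right_iff additive_endos_iff r_distr m_assoc Pi_iff)

lemma (in ring) End_right_comp_left_mult:
  assumes "\<phi> \<in> carrier B \<rightarrow> carrier R" "a \<in> carrier R" "f \<in> carrier (End_right R B \<phi>)"
  shows "(\<lambda>x\<in>carrier R. f (a \<otimes> x)) \<in> carrier (End_right R B \<phi>)"
  using assms
  by (auto simp: End_right_iff additive_endos_iff r_distr m_assoc[symmetric] Pi_iff PiE_iff)

text \<open>
  Since \<open>g\<close> commutes with left multiplication by \<open>a\<close>, evaluating at \<open>1\<close> gives \<open>g a = a g(1)\<close>.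
\<close>

lemma (in ring) End_eval_is_right_mult:
  assumes \<phi>: "\<phi> \<in> carrier B \<rightarrow> carrier R" and g: "g \<in> carrier (End_eval R (End_right R B \<phi>))"
  shows "g = right_mult R (g \<one>)"
proof
  fix a
  show "g a = right_mult R (g \<one>) a"
  proof (cases "a \<in> carrier R")
    case True
    have "g ((\<lambda>x\<in>carrier R. a \<otimes> x) \<one>) = (\<lambda>x\<in>carrier R. a \<otimes> x) (g \<one>)"
      using g left_mult_in_End_right[OF \<phi> True] one_closed unfolding End_eval_iff by blast
    moreover have "g \<one> \<in> carrier R"
      using g by (auto simp: End_eval_iff additive_endos_iff)
    ultimately show ?thesis
      using True by (simp add: right_mult_def)
  next
    case False
    with g show ?thesis
      by (auto simp: End_eval_iff additive_endos_iff right_mult_def PiE_def extensional_def)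
  qed
qed

text \<open>
  It suffices to test \<open>E\<close>-linearity at \<open>1\<close>: the condition \<open>f(a x) = f(a) x\<close> is the condition
  at \<open>1\<close> for the composite of \<open>f\<close> with left multiplication by \<open>a\<close>, which lies in \<open>E\<close> again.
\<close>

lemma (in ring) right_mult_in_End_eval_iff:
  assumes \<phi>: "\<phi> \<in> carrier B \<rightarrow> carrier R" and x: "x \<in> carrier R"
  shows "right_mult R x \<in> carrier (End_eval R (End_right R B \<phi>)) \<longleftrightarrow>
    (\<forall>f\<in>carrier (End_right R B \<phi>). f x = f \<one> \<otimes> x)"
proof
  assume *: "right_mult R x \<in> carrier (End_eval R (End_right R B \<phi>))"
  show "\<forall>f\<in>carrier (End_right R B \<phi>). f x = f \<one> \<otimes> x"
  proof
    fix f assume f: "f \<in> carrier (End_right R B \<phi>)"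
    then have "right_mult R x (f \<one>) = f (right_mult R x \<one>)"
      using * by (simp add: End_eval_iff)
    moreover have "f \<one> \<in> carrier R"
      using f by (auto simp: End_right_iff additive_endos_iff)
    ultimately show "f x = f \<one> \<otimes> x"
      using x by (simp add: right_mult_def)
  qed
next
  assume *: "\<forall>f\<in>carrier (End_right R B \<phi>). f x = f \<one> \<otimes> x"
  have "f a \<otimes> x = f (a \<otimes> x)"
    if f: "f \<in> carrier (End_right R B \<phi>)" and a: "a \<in> carrier R" for f a
    using bspec[OF * End_right_comp_left_mult[OF \<phi> a f]] x a by simp
  moreover have "f a \<in> carrier R" if "f \<in> carrier (End_right R B \<phi>)" "a \<in> carrier R" for f a
    using that by (auto simp: End_right_iff additive_endos_iff)
  moreover have "right_mult R x \<in> additive_endos R"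
    using x by (auto simp: additive_endos_iff right_mult_def l_distr)
  ultimately show "right_mult R x \<in> carrier (End_eval R (End_right R B \<phi>))"
    using x by (auto simp: End_eval_iff right_mult_def)
qed

section \<open>The tensor square and invariance under depth three\<close>

text \<open>
  The bimodule \<open>AA\<close> is \<open>A \<otimes>\<^sub>B A\<close> as a \<open>C\<close>-\<open>A\<close>-bimodule; its factors \<open>CAB\<close> and \<open>BAA\<close> are named after
  the rings acting on \<open>A\<close> from the left and from the right.
\<close>

locale induced_tensor_square =
  A: ring A + B: ring B for A :: "('a, 'x) ring_scheme" and B :: "('b, 'y) ring_scheme" +
  fixes C :: "('c, 'z) ring_scheme" and \<phi> :: "'b \<Rightarrow> 'a" and \<psi> :: "'c \<Rightarrow> 'b"
  assumes \<phi>_hom: "\<phi> \<in> ring_hom B A" and \<psi>_hom: "\<psi> \<in> ring_hom C B"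
begin

abbreviation "CAB \<equiv> induced_bimod A (\<phi> \<circ> \<psi>) \<phi>"
abbreviation "BAA \<equiv> (induced_bimod A \<phi> id :: ('b, 'a, 'a) bimod)"
abbreviation "AA \<equiv> tensor_bimod B CAB BAA"
abbreviation tensor (infixl \<open>\<bullet>\<close> 70) where "a \<bullet> b \<equiv> pure_tensor B CAB BAA a b"

lemma \<phi>_closed: "b \<in> carrier B \<Longrightarrow> \<phi> b \<in> carrier A"
  and \<psi>_closed: "c \<in> carrier C \<Longrightarrow> \<psi> c \<in> carrier B"
  using \<phi>_hom \<psi>_hom by (auto simp: ring_hom_closed)

sublocale tensor_factors B CAB BAA
  by unfold_locales (auto simp: induced_bimod_simps \<phi>_closed)

lemma tensor_closed: "\<lbrakk>a \<in> carrier A; b \<in> carrier A\<rbrakk> \<Longrightarrow> a \<bullet> b \<in> carrier AA"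
  using pure_tensor_closed[of a b] by (simp add: induced_bimod_simps)

lemma tensor_add_left:
  "\<lbrakk>a \<in> carrier A; a' \<in> carrier A; b \<in> carrier A\<rbrakk>
    \<Longrightarrow> (a \<oplus>\<^bsub>A\<^esub> a') \<bullet> b = (a \<bullet> b) \<otimes>\<^bsub>AA\<^esub> (a' \<bullet> b)"
  using pure_tensor_add_left[of a a' b] by (simp add: induced_bimod_simps)

lemma tensor_balanced:
  "\<lbrakk>a \<in> carrier A; b \<in> carrier B; a' \<in> carrier A\<rbrakk>
    \<Longrightarrow> (a \<otimes>\<^bsub>A\<^esub> \<phi> b) \<bullet> a' = a \<bullet> (\<phi> b \<otimes>\<^bsub>A\<^esub> a')"
  using pure_tensor_balanced[of a b a'] by (simp add: induced_bimod_simps)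

lemma lact_tensor:
  assumes "c \<in> carrier C" "a \<in> carrier A" "b \<in> carrier A"
  shows "lact AA c (a \<bullet> b) = (\<phi> (\<psi> c) \<otimes>\<^bsub>A\<^esub> a) \<bullet> b"
  using assms lact_pure_tensor[of c a b]
  by (simp add: induced_bimod_simps \<phi>_closed \<psi>_closed A.r_distr A.m_assoc)

lemma ract_tensor:
  assumes "s \<in> carrier A" "a \<in> carrier A" "b \<in> carrier A"
  shows "ract AA (a \<bullet> b) s = a \<bullet> (b \<otimes>\<^bsub>A\<^esub> s)"
  using assms ract_pure_tensor[of s a b]
  by (simp add: induced_bimod_simps \<phi>_closed A.l_distr A.m_assoc)

text \<open>
  Right \<open>B\<close>-linearity of \<open>f\<close> makes \<open>(a, b) \<mapsto> f(a) b\<close> balanced.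
\<close>

lemma End_right_tensor_eq:
  assumes f: "f \<in> carrier (End_right A B \<phi>)"
    and ab: "a \<in> carrier A" "b \<in> carrier A" "a' \<in> carrier A" "b' \<in> carrier A"
    and eq: "a \<bullet> b = a' \<bullet> b'"
  shows "f a \<otimes>\<^bsub>A\<^esub> b = f a' \<otimes>\<^bsub>A\<^esub> b'"
proof -
  have f_closed: "\<And>x. x \<in> carrier A \<Longrightarrow> f x \<in> carrier A"
    using f by (auto simp: End_right_iff additive_endos_iff)
  have G: "comm_group (add_monoid A)"
    by (rule A.a_comm_group)
  show ?thesis
    by (rule balanced_map_eq[OF G, where \<beta> = "\<lambda>a b. f a \<otimes>\<^bsub>A\<^esub> b"])
      (use f ab eq in \<open>auto simp: induced_bimod_simps f_closed \<phi>_closed A.l_distr A.r_distr A.m_assoc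
        End_right_iff additive_endos_iff\<close>)
qed

text \<open>
  A bimodule map from the tensor square into a power of \<open>A\<close> is a source of elements of
  \<open>End \<^sub>CA\<^sub>B\<close>: one for each coordinate.  Right \<open>A\<close>-linearity turns into right \<open>B\<close>-linearity because
  a scalar from \<open>B\<close> can be moved across the tensor sign.
\<close>

lemma component_in_End_bimod:
  assumes h: "h \<in> bimod_hom C A AA (power_bimod (induced_bimod A (\<phi> \<circ> \<psi>) id) n)"
    and i: "i < n"
  shows "(\<lambda>a\<in>carrier A. h (a \<bullet> \<one>\<^bsub>A\<^esub>) i) \<in> carrier (End_bimod A B C \<phi> \<psi>)"
proof -
  have h_closed: "h t i \<in> carrier A" if "t \<in> carrier AA" for t
    using h i that by (auto simp: bimod_hom_def hom_def power_bimod_simps induced_bimod_simps)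
  have h_add: "h (s \<otimes>\<^bsub>AA\<^esub> t) i = h s i \<oplus>\<^bsub>A\<^esub> h t i" if "s \<in> carrier AA" "t \<in> carrier AA" for s t
    using h i that by (auto simp: bimod_hom_def hom_def power_bimod_simps induced_bimod_simps)
  have h_lact: "h (lact AA c t) i = \<phi> (\<psi> c) \<otimes>\<^bsub>A\<^esub> h t i" if "c \<in> carrier C" "t \<in> carrier AA" for c t
    using h i that by (auto simp: bimod_hom_def power_bimod_simps induced_bimod_simps)
  have h_ract: "h (ract AA t s) i = h t i \<otimes>\<^bsub>A\<^esub> s" if "s \<in> carrier A" "t \<in> carrier AA" for s t
    using h i that by (auto simp: bimod_hom_def power_bimod_simps induced_bimod_simps)
  have right: "h ((a \<otimes>\<^bsub>A\<^esub> \<phi> b) \<bullet> \<one>\<^bsub>A\<^esub>) i = h (a \<bullet> \<one>\<^bsub>A\<^esub>) i \<otimes>\<^bsub>A\<^esub> \<phi> b"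
    if "a \<in> carrier A" "b \<in> carrier B" for a b
  proof -
    have "(a \<otimes>\<^bsub>A\<^esub> \<phi> b) \<bullet> \<one>\<^bsub>A\<^esub> = ract AA (a \<bullet> \<one>\<^bsub>A\<^esub>) (\<phi> b)"
      using that by (simp add: tensor_balanced ract_tensor \<phi>_closed)
    then show ?thesis
      using that by (simp add: h_ract tensor_closed \<phi>_closed)
  qed
  show ?thesis
    by (auto simp: End_bimod_iff End_right_iff additive_endos_iff h_closed tensor_closed
        tensor_add_left h_add right \<phi>_closed \<psi>_closed lact_tensor[symmetric] h_lact)
qed

text \<open>
  Invariance of \<open>x\<close> under each coordinate of the embedding \<open>h\<close> of the tensor square into \<open>A\<^sup>n\<close> says
  that \<open>h (x \<otimes> 1)\<close> and \<open>h ((1 \<otimes> 1) x)\<close> agree, and \<open>h\<close> is injective.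
\<close>

lemma invariant_tensor_swap:
  assumes depth: "left_depth_three A B C \<phi> \<psi>"
    and x: "x \<in> endo_invariants A (End_bimod A B C \<phi> \<psi>)"
  shows "x \<bullet> \<one>\<^bsub>A\<^esub> = \<one>\<^bsub>A\<^esub> \<bullet> x"
proof -
  have xA: "x \<in> carrier A"
    using x by (simp add: endo_invariants_def)
  obtain n P h where P: "direct_summand C A P (power_bimod (induced_bimod A (\<phi> \<circ> \<psi>) id) n)"
    and h: "h \<in> bimod_iso C A AA ((power_bimod (induced_bimod A (\<phi> \<circ> \<psi>) id) n)\<lparr>carrier := P\<rparr>)"
    using depth unfolding left_depth_three_def by blast
  let ?An = "power_bimod (induced_bimod A (\<phi> \<circ> \<psi>) id) n :: ('c, 'a, nat \<Rightarrow> 'a) bimod"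
  have "P \<subseteq> carrier ?An"
    using P unfolding direct_summand_def sub_bimod_def by (blast dest: subgroup.subset)
  then have h_hom: "h \<in> bimod_hom C A AA ?An"
    using h by (auto simp: bimod_iso_def bimod_hom_def hom_def)
  have h_inj: "inj_on h (carrier AA)"
    using h by (simp add: bimod_iso_def bij_betw_def)
  have h_ext: "h t \<in> {..<n} \<rightarrow>\<^sub>E carrier A" if "t \<in> carrier AA" for t
    using h_hom that by (auto simp: bimod_hom_def hom_def power_bimod_simps induced_bimod_simps)
  have "h (x \<bullet> \<one>\<^bsub>A\<^esub>) = h (ract AA (\<one>\<^bsub>A\<^esub> \<bullet> \<one>\<^bsub>A\<^esub>) x)"
  proof
    fix i
    show "h (x \<bullet> \<one>\<^bsub>A\<^esub>) i = h (ract AA (\<one>\<^bsub>A\<^esub> \<bullet> \<one>\<^bsub>A\<^esub>) x) i"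
    proof (cases "i < n")
      case True
      have "h (x \<bullet> \<one>\<^bsub>A\<^esub>) i = h (\<one>\<^bsub>A\<^esub> \<bullet> \<one>\<^bsub>A\<^esub>) i \<otimes>\<^bsub>A\<^esub> x"
        using x component_in_End_bimod[OF h_hom True]
        unfolding endo_invariants_def by fastforce
      also have "\<dots> = h (ract AA (\<one>\<^bsub>A\<^esub> \<bullet> \<one>\<^bsub>A\<^esub>) x) i"
        using h_hom True xA tensor_closed[of "\<one>\<^bsub>A\<^esub>" "\<one>\<^bsub>A\<^esub>"]
        by (simp add: bimod_hom_def power_bimod_simps induced_bimod_simps)
      finally show ?thesis .
    next
      case False
      \<comment> \<open>Elements of the power are extensional, so both sides are undefined outside the index set.\<close>
      have "ract AA (\<one>\<^bsub>A\<^esub> \<bullet> \<one>\<^bsub>A\<^esub>) x \<in> carrier AA"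
        using xA by (simp add: ract_tensor tensor_closed)
      with False show ?thesis
        using xA PiE_arb[OF h_ext, of _ i] by (simp add: tensor_closed)
    qed
  qed
  then show ?thesis
    using xA h_inj by (simp add: ract_tensor tensor_closed inj_on_eq_iff)
qed

text \<open>
  The inclusion from left to right carries the theorem: apply the map \<open>a \<otimes> b \<mapsto> f(a) b\<close> to
  \<open>x \<otimes> 1 = 1 \<otimes> x\<close>.
\<close>

lemma endo_invariants_eq:
  assumes "left_depth_three A B C \<phi> \<psi>"
  shows "endo_invariants A (End_bimod A B C \<phi> \<psi>) =
    {x \<in> carrier A. \<forall>f\<in>carrier (End_right A B \<phi>). f x = f \<one>\<^bsub>A\<^esub> \<otimes>\<^bsub>A\<^esub> x}"
proof (intro equalityI subsetI)
  fix x assume x: "x \<in> endo_invariants A (End_bimod A B C \<phi> \<psi>)"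
  then have xA: "x \<in> carrier A"
    by (simp add: endo_invariants_def)
  moreover have "f x = f \<one>\<^bsub>A\<^esub> \<otimes>\<^bsub>A\<^esub> x" if f: "f \<in> carrier (End_right A B \<phi>)" for f
  proof -
    have "f x \<in> carrier A"
      using f xA by (auto simp: End_right_iff additive_endos_iff)
    then show ?thesis
      using End_right_tensor_eq[OF f _ _ _ _ invariant_tensor_swap[OF assms x]] xA by simp
  qed
  ultimately show "x \<in> {x \<in> carrier A. \<forall>f\<in>carrier (End_right A B \<phi>). f x = f \<one>\<^bsub>A\<^esub> \<otimes>\<^bsub>A\<^esub> x}"
    by blast
qed (auto simp: endo_invariants_def End_bimod_iff)

end

section \<open>The anti-isomorphism\<close>

lemma (in ring) ring_opposite: "ring (R\<lparr>monoid.mult := \<lambda>x y. y \<otimes> x\<rparr>)"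
proof (rule ringI)
  have "add_monoid (R\<lparr>monoid.mult := \<lambda>x y. y \<otimes> x\<rparr>) = add_monoid R"
    by simp
  then show "abelian_group (R\<lparr>monoid.mult := \<lambda>x y. y \<otimes> x\<rparr>)"
    using abelian_group_axioms
    by (simp add: abelian_group_def abelian_monoid_def abelian_group_axioms_def)
  show "monoid (R\<lparr>monoid.mult := \<lambda>x y. y \<otimes> x\<rparr>)"
    by (rule monoidI) (auto simp: m_assoc)
qed (auto simp: l_distr r_distr)

text \<open>
  For closure under products, \<open>f(x y) = f(x) y\<close> is invariance of \<open>y\<close> under \<open>f\<close> composed with left
  multiplication by \<open>x\<close>.  Such a composite of \<open>f \<in> J\<close> need not lie in \<open>J\<close>, which is why the
  invariants are taken under all right \<open>B\<close>-linear endomorphisms.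
\<close>

lemma (in ring) subring_right_invariants:
  assumes \<phi>: "\<phi> \<in> carrier B \<rightarrow> carrier R"
  shows "subring {x \<in> carrier R. \<forall>f\<in>carrier (End_right R B \<phi>). f x = f \<one> \<otimes> x} R" (is "subring ?I R")
proof (rule subringI)
  have f_closed: "f x \<in> carrier R" if "f \<in> carrier (End_right R B \<phi>)" "x \<in> carrier R" for f x
    using that by (auto simp: End_right_iff additive_endos_iff)
  have f_add: "f (x \<oplus> y) = f x \<oplus> f y"
    if "f \<in> carrier (End_right R B \<phi>)" "x \<in> carrier R" "y \<in> carrier R" for f x y
    using that by (auto simp: End_right_iff additive_endos_iff)
  show "?I \<subseteq> carrier R" by blast
  show "\<one> \<in> ?I" by (auto simp: f_closed)
  show "x \<oplus> y \<in> ?I" if "x \<in> ?I" "y \<in> ?I" for x y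
    using that by (auto simp: f_closed f_add r_distr)
  show "\<ominus> x \<in> ?I" if x: "x \<in> ?I" for x
  proof -
    have "f (\<ominus> x) = f \<one> \<otimes> \<ominus> x" if f: "f \<in> carrier (End_right R B \<phi>)" for f
    proof -
      have "group_hom (add_monoid R) (add_monoid R) f"
        using f by (auto simp: group_hom_def group_hom_axioms_def hom_def f_closed f_add
            intro: a_group)
      then have "f (\<ominus> x) = \<ominus> f x"
        using x group_hom.hom_inv[of "add_monoid R" "add_monoid R" f x] by (simp add: a_inv_def)
      then show ?thesis
        using x f by (simp add: f_closed r_minus)
    qed
    then show ?thesis using x by simp
  qed
  show "x \<otimes> y \<in> ?I" if x: "x \<in> ?I" and y: "y \<in> ?I" for x y
  proof -
    have "f (x \<otimes> y) = f \<one> \<otimes> (x \<otimes> y)" if f: "f \<in> carrier (End_right R B \<phi>)" for f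
    proof -
      have "(\<lambda>z\<in>carrier R. f (x \<otimes> z)) y = (\<lambda>z\<in>carrier R. f (x \<otimes> z)) \<one> \<otimes> y"
        using y End_right_comp_left_mult[OF \<phi> _ f, of x] x by blast
      then have "f (x \<otimes> y) = f x \<otimes> y"
        using x y by simp
      also have "\<dots> = f \<one> \<otimes> x \<otimes> y"
        using x f by simp
      also have "\<dots> = f \<one> \<otimes> (x \<otimes> y)"
        using x y f_closed[OF f one_closed] by (simp add: m_assoc)
      finally show ?thesis .
    qed
    then show ?thesis using x y by simp
  qed
qed

theorem theorem5p3:
  fixes A :: "('a, 'x) ring_scheme" and B :: "('b, 'y) ring_scheme" and C :: "('c, 'z) ring_scheme"
    and \<phi> :: "'b \<Rightarrow> 'a" and \<psi> :: "'c \<Rightarrow> 'b"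
  assumes "ring_tower A B C \<phi> \<psi>"
    and "left_depth_three A B C \<phi> \<psi>"
  defines "E \<equiv> End_right A B \<phi>"
    and "J \<equiv> End_bimod A B C \<phi> \<psi>"
  shows "subring (endo_invariants A J) A \<and>
    right_mult A \<in> ring_anti_iso (A\<lparr>carrier := endo_invariants A J\<rparr>) (End_eval A E)"
proof -
  interpret induced_tensor_square A B C \<phi> \<psi>
    using assms(1) by (simp add: ring_tower_def induced_tensor_square_def
        induced_tensor_square_axioms_def)
  have \<phi>: "\<phi> \<in> carrier B \<rightarrow> carrier A"
    by (simp add: \<phi>_closed)
  let ?I = "endo_invariants A J"
  let ?R = "A\<lparr>carrier := ?I\<rparr>"
  let ?Rop = "?R\<lparr>monoid.mult := \<lambda>x y. y \<otimes>\<^bsub>?R\<^esub> x\<rparr>"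
  have I_eq: "?I = {x \<in> carrier A. \<forall>f\<in>carrier E. f x = f \<one>\<^bsub>A\<^esub> \<otimes>\<^bsub>A\<^esub> x}"
    unfolding E_def J_def by (rule endo_invariants_eq[OF assms(2)])
  have subring: "subring ?I A"
    unfolding I_eq unfolding E_def by (rule A.subring_right_invariants[OF \<phi>])
  have I_carrier: "x \<in> carrier A" if "x \<in> ?I" for x
    using that by (simp add: endo_invariants_def)
  have mem_iff: "right_mult A x \<in> carrier (End_eval A E) \<longleftrightarrow> x \<in> ?I" if "x \<in> carrier A" for x
    using that A.right_mult_in_End_eval_iff[OF \<phi>] unfolding I_eq unfolding E_def by simp
  have "bij_betw (right_mult A) ?I (carrier (End_eval A E))"
  proof (rule bij_betwI')
    fix x y assume "x \<in> ?I" "y \<in> ?I"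
    then have "right_mult A x \<one>\<^bsub>A\<^esub> = x" "right_mult A y \<one>\<^bsub>A\<^esub> = y"
      by (simp_all add: right_mult_def I_carrier)
    then show "right_mult A x = right_mult A y \<longleftrightarrow> x = y"
      by metis
  next
    fix x assume "x \<in> ?I"
    then show "right_mult A x \<in> carrier (End_eval A E)"
      using mem_iff I_carrier by blast
  next
    fix g assume g: "g \<in> carrier (End_eval A E)"
    then have "g \<one>\<^bsub>A\<^esub> \<in> carrier A"
      by (auto simp: End_eval_iff additive_endos_iff)
    moreover have "g = right_mult A (g \<one>\<^bsub>A\<^esub>)"
      using A.End_eval_is_right_mult[OF \<phi>] g unfolding E_def by blast
    ultimately show "\<exists>x\<in>?I. g = right_mult A x"
      using g mem_iff by metis
  qed
  moreover have "right_mult A \<in> ring_hom ?Rop (End_eval A E)"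
  proof (rule ring_hom_memI)
    fix x assume "x \<in> carrier ?Rop"
    then show "right_mult A x \<in> carrier (End_eval A E)"
      using mem_iff I_carrier by simp
  qed (auto simp: End_eval_def endo_ring_simps right_mult_def compose_def I_carrier
      A.m_assoc A.r_distr intro!: restrict_ext)
  ultimately have iso: "right_mult A \<in> ring_iso ?Rop (End_eval A E)"
    by (simp add: ring_iso_def)
  have R: "ring ?R"
    using subring by (rule A.subring_is_ring)
  \<comment> \<open>Transport of structure prescribes the image of zero as the new zero; it is the old one.\<close>
  have zero: "(End_eval A E)\<lparr>zero := right_mult A \<zero>\<^bsub>A\<^esub>\<rparr> = End_eval A E"
    by (simp add: End_eval_def endo_ring_def right_mult_def cong: restrict_cong)
  have "ring (End_eval A E)"
    using ring.ring_iso_imp_img_ring[OF ring.ring_opposite[OF R] iso] zero by simp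
  then show ?thesis
    using subring R iso unfolding ring_anti_iso_def by blast
qed

end
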